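(* For every integer $r \geq 2$, $$\sum_{n=0}^{+\infty} \frac{1}{F_{2^r n + 2^{r-1}}\, \Phi^{2^r n + 2^{r-1}}} = \sum_{n=1}^{+\infty} \frac{1}{F_{2^r n}}.$$
   Context: $(F_n)$ is the Fibonacci sequence: $F_0 = 0$, $F_1 = 1$, $F_{n+2} = F_{n+1} + F_n$. $\Phi = \frac{1+\sqrt{5}}{2}$ is the golden ratio. *)

theory Defs
  imports "HOL-Analysis.Analysis" "HOL-Number_Theory.Fib"
begin

definition golden_ratio :: real
  where "golden_ratio = (1 + sqrt 5) / 2"

end

theory Submission
  imports Defs
begin

text \<open>
  For even \<open>m\<close>, Binet's formula reads \<open>F\<^sub>m = (\<Phi>\<^sup>m - \<Phi>\<^bsup>-m\<^esup>) / \<surd>5\<close>. Put \<open>w = \<Phi>\<close> to the power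
  \<open>- 2\<^sup>r\<close>. Up to the factor \<open>\<surd>5\<close>, the two sides are the Lambert-type series
  \<open>\<Sum> w\<^bsup>2n+1\<^esup> / (1 - w\<^bsup>2n+1\<^esup>)\<close> and \<open>\<Sum> w\<^bsup>k+1\<^esup> / (1 - w\<^bsup>2(k+1)\<^esup>)\<close>; expanding either one
  geometrically gives the double series of \<open>w\<^bsup>(2n+1)(k+1)\<^esup>\<close> over all \<open>n\<close> and \<open>k\<close>, summed in the
  two possible orders.
\<close>

lemma lambert_odd_sums:
  fixes w :: real
  assumes "0 < w" "w < 1"
  obtains S where "(\<lambda>n. w ^ (2 * n + 1) / (1 - w ^ (2 * n + 1))) sums S"
    and "(\<lambda>k. w ^ (k + 1) / (1 - w ^ (2 * (k + 1)))) sums S"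
proof -
  define f where "f = (\<lambda>(n::nat, k::nat). w ^ ((2 * n + 1) * (k + 1)))"
  have rows: "((\<lambda>k. f (n, k)) has_sum w ^ (2 * n + 1) / (1 - w ^ (2 * n + 1))) UNIV" for n
  proof (rule sums_nonneg_imp_has_sum)
    have "w ^ (2 * n + 1) < 1"
      using assms by (subst power_less_one_iff) auto
    then have "(\<lambda>k. w ^ (2 * n + 1) * (w ^ (2 * n + 1)) ^ k) sums
        (w ^ (2 * n + 1) * (1 / (1 - w ^ (2 * n + 1))))"
      using assms by (intro sums_mult geometric_sums) simp
    moreover have "w ^ (2 * n + 1) * (w ^ (2 * n + 1)) ^ k = f (n, k)" for k
      unfolding f_def prod.case power_mult[symmetric] power_add[symmetric]
      by (rule arg_cong[of _ _ "power w"]) (simp add: algebra_simps)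
    ultimately show "(\<lambda>k. f (n, k)) sums (w ^ (2 * n + 1) / (1 - w ^ (2 * n + 1)))"
      by simp
  qed (use assms in \<open>simp add: f_def\<close>)
  have columns: "((\<lambda>n. f (n, k)) has_sum w ^ (k + 1) / (1 - w ^ (2 * (k + 1)))) UNIV" for k
  proof (rule sums_nonneg_imp_has_sum)
    have "w ^ (2 * (k + 1)) < 1"
      using assms by (subst power_less_one_iff) auto
    \<comment> \<open>For fixed \<open>k\<close> the exponent is (2n + 1)(k + 1) = (k + 1) + 2(k +
      1)n, hence the ratio \<open>w ^ (2 * (k + 1))\<close>.\<close>
    then have "(\<lambda>n. w ^ (k + 1) * (w ^ (2 * (k + 1))) ^ n) sums
        (w ^ (k + 1) * (1 / (1 - w ^ (2 * (k + 1)))))"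
      using assms by (intro sums_mult geometric_sums) simp
    moreover have "w ^ (k + 1) * (w ^ (2 * (k + 1))) ^ n = f (n, k)" for n
      unfolding f_def prod.case power_mult[symmetric] power_add[symmetric]
      by (rule arg_cong[of _ _ "power w"]) (simp add: algebra_simps)
    ultimately show "(\<lambda>n. f (n, k)) sums (w ^ (k + 1) / (1 - w ^ (2 * (k + 1))))"
      by simp
  qed (use assms in \<open>simp add: f_def\<close>)
  have nonneg: "w ^ (2 * n + 1) / (1 - w ^ (2 * n + 1)) \<ge> 0" for n
    using assms by (intro has_sum_nonneg[OF rows]) (simp add: f_def)
  have "summable (\<lambda>n. w ^ (2 * n + 1) / (1 - w ^ (2 * n + 1)))"
  proof (rule summable_comparison_test')
    show "summable (\<lambda>n. w ^ n / (1 - w))"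
      using assms by (intro summable_divide summable_geometric) simp
    show "norm (w ^ (2 * n + 1) / (1 - w ^ (2 * n + 1))) \<le> w ^ n / (1 - w)" if "n \<ge> 0" for n
    proof -
      \<comment> \<open>The first bound enlarges the numerator, the second shrinks the denominator
        to 1 - w, leaving a geometric majorant.\<close>
      have "w ^ (2 * n + 1) \<le> w ^ n" "w ^ (2 * n + 1) \<le> w ^ 1"
        using assms by (intro power_decreasing; simp)+
      then have "w ^ (2 * n + 1) / (1 - w ^ (2 * n + 1)) \<le> w ^ n / (1 - w)"
        using assms by (intro frac_le) simp_all
      then show ?thesis
        using nonneg[of n] by (simp only: real_norm_def abs_of_nonneg)
    qed
  qed
  then have "(\<lambda>n. w ^ (2 * n + 1) / (1 - w ^ (2 * n + 1))) summable_on UNIV"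
    using nonneg by (rule summable_nonneg_imp_summable_on)
  \<comment> \<open>As all terms are nonnegative, summable row sums make the whole double family
    summable; both iterated sums then equal its sum \<open>S\<close>.\<close>
  then have "f summable_on UNIV \<times> UNIV"
    using rows assms by (intro summable_on_SigmaI) (auto simp: f_def)
  then obtain S where S: "(f has_sum S) (UNIV \<times> UNIV)"
    by (auto simp: summable_on_def)
  then have S': "((\<lambda>(k, n). f (n, k)) has_sum S) (UNIV \<times> UNIV)"
    by (subst (asm) has_sum_swap) (simp add: case_prod_unfold)
  have "((\<lambda>k. w ^ (k + 1) / (1 - w ^ (2 * (k + 1)))) has_sum S) UNIV"
    by (rule has_sum_SigmaD[OF S']) (unfold prod.case, rule columns)
  with has_sum_SigmaD[OF S rows] show thesis
    by (intro that has_sum_imp_sums)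
qed

lemma golden_ratio_gt_1: "golden_ratio > 1"
  unfolding golden_ratio_def by (simp add: real_less_rsqrt)

text \<open>The roots of x^2 - x - 1 have product -1, so the conjugate root in Binet's formula is
  -1/\<Phi>; an even exponent removes its sign.\<close>

lemma fib_even_golden_ratio:
  assumes "even m"
  shows "real (fib m) = (golden_ratio ^ m - 1 / golden_ratio ^ m) / sqrt 5"
proof -
  have "(1 - sqrt 5) / 2 * golden_ratio = - 1"
    by (simp add: golden_ratio_def field_simps)
  then have "(1 - sqrt 5) / 2 = - 1 / golden_ratio"
    using golden_ratio_gt_1 by (subst nonzero_eq_divide_eq) simp_all
  then show ?thesis
    using assms by (simp add: fib_closed_form golden_ratio_def[symmetric] power_divide)
qed

theorem theorem3p4:
  fixes r :: nat
  assumes "r \<ge> 2"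
  shows "summable (\<lambda>n::nat. 1 / (real (fib (2 ^ r * n + 2 ^ (r - 1))) * golden_ratio ^ (2 ^ r * n + 2 ^ (r - 1))))
    \<and> summable (\<lambda>n::nat. 1 / real (fib (2 ^ r * (n + 1))))
    \<and> (\<Sum>n::nat. 1 / (real (fib (2 ^ r * n + 2 ^ (r - 1))) * golden_ratio ^ (2 ^ r * n + 2 ^ (r - 1))))
       = (\<Sum>n::nat. 1 / real (fib (2 ^ r * (n + 1))))"
proof -
  define h :: nat where "h = 2 ^ (r - 1)"
  define w where "w = 1 / golden_ratio ^ (2 * h)"
  have r: "2 ^ r = 2 * h"
    using assms by (simp add: h_def flip: power_Suc)
  \<comment> \<open>Evenness of \<open>h\<close> comes from r \<ge> 2. It makes the left-hand
    indices h(2n + 1) even, as the sign-free Binet formula requires.\<close>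
  have "even h" "h > 0"
    using assms by (simp_all add: h_def)
  have w: "0 < w" "w < 1"
    using golden_ratio_gt_1 \<open>h > 0\<close> by (simp_all add: w_def one_less_power)
  have pow: "w ^ k = 1 / golden_ratio ^ (2 * h * k)" for k
    by (simp add: w_def power_divide flip: power_mult)
  have left: "1 / (real (fib (2 ^ r * n + 2 ^ (r - 1))) * golden_ratio ^ (2 ^ r * n + 2 ^ (r - 1)))
      = sqrt 5 * (w ^ (2 * n + 1) / (1 - w ^ (2 * n + 1)))" for n
  proof -
    define m where "m = h * (2 * n + 1)"
    have m: "2 ^ r * n + 2 ^ (r - 1) = m" "2 * h * (2 * n + 1) = 2 * m" "even m" "m > 0"
      using \<open>even h\<close> \<open>h > 0\<close> unfolding r h_def[symmetric] by (simp_all add: m_def algebra_simps)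
    \<comment> \<open>With G = \<Phi>^m, Binet gives F_m G = (G^2 - 1)/sqrt 5. Its reciprocal is
      sqrt 5 times G^(-2)/(1 - G^(-2)), and G^(-2) is the odd power of \<open>w\<close>.\<close>
    define G where "G = golden_ratio ^ m"
    have "G > 1"
      using golden_ratio_gt_1 m by (simp add: G_def one_less_power)
    then have "G * G > 1"
      using less_1_mult by blast
    have w_G: "w ^ (2 * n + 1) = 1 / (G * G)"
      unfolding pow m G_def by (simp add: mult_2 power_add)
    show ?thesis
      unfolding m w_G fib_even_golden_ratio[OF \<open>even m\<close>] G_def[symmetric]
      using \<open>G > 1\<close> \<open>G * G > 1\<close> by (simp add: field_simps)
  qed
  have right: "1 / real (fib (2 ^ r * (n + 1))) = sqrt 5 * (w ^ (n + 1) / (1 - w ^ (2 * (n + 1))))" for n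
  proof -
    define m where "m = 2 * h * (n + 1)"
    have m: "2 * h * (2 * (n + 1)) = 2 * m" "even m" "m > 0"
      using \<open>h > 0\<close> by (simp_all add: m_def)
    \<comment> \<open>Here 1/F_m = sqrt 5/(G - 1/G), which is sqrt 5 times G^(-1)/(1 - G^(-2)).
      Without the extra factor \<Phi>^m the numerator is only G^(-1).\<close>
    define G where "G = golden_ratio ^ m"
    have "G > 1"
      using golden_ratio_gt_1 m by (simp add: G_def one_less_power)
    then have "G * G > 1"
      using less_1_mult by blast
    have w_G: "w ^ (n + 1) = 1 / G" "w ^ (2 * (n + 1)) = 1 / (G * G)"
      unfolding pow m G_def m_def[symmetric] by (simp_all add: mult_2 power_add)
    show ?thesis
      unfolding w_G r m_def[symmetric] fib_even_golden_ratio[OF \<open>even m\<close>] G_def[symmetric]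
      using \<open>G > 1\<close> \<open>G * G > 1\<close> by (simp add: field_simps)
  qed
  obtain S where S: "(\<lambda>n. w ^ (2 * n + 1) / (1 - w ^ (2 * n + 1))) sums S"
    "(\<lambda>k. w ^ (k + 1) / (1 - w ^ (2 * (k + 1)))) sums S"
    using lambert_odd_sums[OF w] .
  show ?thesis
    unfolding left right
    using S[THEN sums_mult, of "sqrt 5"] unfolding sums_iff by (elim conjE) (intro conjI; simp only:)
qed

end
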